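(* Let $R\subset\mathbb R/\mathbb Z$ be the set of (irrational) dyadically recurrent elements. (a) If $r\in R$, then $\varsigma^z(t):=t+zr$ defines a dyadically recurrent $\mathbb Z$-action on $\mathbb R/\mathbb Z$. (b) $R$ is a dense $G_\delta$ subset of $\mathbb R/\mathbb Z$, but $\lambda[R]=0$.
   Context: Identify $\mathbb R/\mathbb Z$ with $[0,1)$; $d$ is the usual metric and $\lambda$ Lebesgue measure. An irrational $r\in[0,1)$ with binary expansion $r=0.r_1r_2r_3\ldots$ is dyadically recurrent if there is a sequence of natural numbers $n_k\to\infty$ such that for every $k$, $r_j=0$ for all integers $j$ with $n_k<j\le2n_k$. A $\mathbb Z$-action $\varsigma$ on $\mathbb R/\mathbb Z$ by rotations is dyadically recurrent if there is a sequence of natural numbers $n_k\to\infty$ with $d(\varsigma^{2^{n_k}}(t),t)<2^{-n_k}$ for all $t\in\mathbb R/\mathbb Z$ and all $k$. *)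

theory Defs
  imports "HOL-Analysis.Analysis" "HOL-Algebra.Elementary_Groups" "HOL-Algebra.Group_Action"
begin

text \<open>The group R/Z is identified with the interval from 0 (included) to 1 (excluded): sums are
  taken in the reals and reduced by \<^const>\<open>frac\<close>, and the metric is the quotient metric, the
  distance of the real number \<open>s - t\<close> to the nearest integer.\<close>

definition circle :: "real set" where
  "circle = {0..<1}"

definition circle_dist :: "real \<Rightarrow> real \<Rightarrow> real" where
  "circle_dist s t = infdist (s - t) \<int>"

lemma infdist_Ints_minus: "infdist (- x) \<int> = infdist (x :: real) \<int>"
proof -
  have le: "infdist (- y) \<int> \<le> infdist y \<int>" for y :: real
  proof -
    have "infdist (- y) \<int> \<le> dist y a" if "a \<in> \<int>" for a
      using infdist_le[of "- a" \<int> "- y"] that by (simp add: dist_minus)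
    then show ?thesis
      by (subst infdist_notempty[of \<int> y]) (auto intro!: cINF_greatest)
  qed
  show ?thesis
    using le[of x] le[of "- x"] by simp
qed

lemma infdist_Ints_add: "infdist (x + y) \<int> \<le> infdist x \<int> + infdist (y :: real) \<int>"
proof -
  have "infdist (x + y) \<int> - dist y b \<le> dist x a" if "a \<in> \<int>" "b \<in> \<int>" for a b
    using infdist_le[of "a + b" \<int> "x + y"] that dist_triangle_add[of x y a b] by auto
  then have "infdist (x + y) \<int> - dist y b \<le> infdist x \<int>" if "b \<in> \<int>" for b
    using that by (subst infdist_notempty[of \<int> x]) (auto intro!: cINF_greatest)
  then have "infdist (x + y) \<int> - infdist x \<int> \<le> dist y b" if "b \<in> \<int>" for b
    using that by (simp add: algebra_simps)
  then have "infdist (x + y) \<int> - infdist x \<int> \<le> infdist y \<int>"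
    by (subst infdist_notempty[of \<int> y]) (auto intro!: cINF_greatest)
  then show ?thesis by simp
qed

lemma Metric_space_circle: "Metric_space circle circle_dist"
proof
  show "0 \<le> circle_dist s t" for s t
    by (simp add: circle_dist_def infdist_nonneg)
  show "circle_dist s t = circle_dist t s" for s t
    using infdist_Ints_minus[of "s - t"] by (simp add: circle_dist_def)
  show "circle_dist s t = 0 \<longleftrightarrow> s = t" if "s \<in> circle" "t \<in> circle" for s t
  proof
    assume "circle_dist s t = 0"
    then have "s - t \<in> \<int>"
      using in_closed_iff_infdist_zero[of "\<int> :: real set" "s - t"]
      by (auto simp: circle_dist_def)
    moreover have "\<bar>s - t\<bar> < 1"
      using that by (auto simp: circle_def)
    ultimately show "s = t"
      using Ints_nonzero_abs_less1[of "s - t"] by auto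
  qed (simp add: circle_dist_def)
  show "circle_dist s u \<le> circle_dist s t + circle_dist t u" for s t u
    using infdist_Ints_add[of "s - t" "t - u"] by (simp add: circle_dist_def)
qed

definition circle_topology :: "real topology" where
  "circle_topology = Metric_space.mtopology circle circle_dist"

text \<open>Only the digits \<open>b 1, b 2, \<dots>\<close> are relevant.\<close>

definition binary_expansion :: "(nat \<Rightarrow> nat) \<Rightarrow> real \<Rightarrow> bool" where
  "binary_expansion b r \<longleftrightarrow>
     (\<forall>j\<ge>1. b j \<in> {0, 1}) \<and> (\<lambda>j. real (b (Suc j)) / 2 ^ Suc j) sums r"

text \<open>An irrational number has exactly one binary expansion, so the existential quantifier
  over \<open>b\<close> makes no choice.\<close>

definition dyadically_recurrent :: "real \<Rightarrow> bool" where
  "dyadically_recurrent r \<longleftrightarrow> r \<in> circle \<and> r \<notin> \<rat> \<and>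
     (\<exists>b. binary_expansion b r \<and>
       (\<exists>n :: nat \<Rightarrow> nat. filterlim n at_top sequentially \<and>
         (\<forall>k j. n k < j \<and> j \<le> 2 * n k \<longrightarrow> b j = 0)))"

text \<open>\<^const>\<open>group_action\<close> requires each \<open>\<sigma> z\<close> to be a bijection of the circle that
  is extensional (undefined outside the circle); hence the restricted abstraction below.\<close>

definition rotation :: "real \<Rightarrow> real \<Rightarrow> real" where
  "rotation a = (\<lambda>t\<in>circle. frac (t + a))"

definition rotation_action :: "(int \<Rightarrow> real \<Rightarrow> real) \<Rightarrow> bool" where
  "rotation_action \<sigma> \<longleftrightarrow>
     group_action integer_group circle \<sigma> \<and> (\<forall>z. \<exists>a\<in>circle. \<sigma> z = rotation a)"

definition dyadically_recurrent_action :: "(int \<Rightarrow> real \<Rightarrow> real) \<Rightarrow> bool" where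
  "dyadically_recurrent_action \<sigma> \<longleftrightarrow> rotation_action \<sigma> \<and>
     (\<exists>n :: nat \<Rightarrow> nat. filterlim n at_top sequentially \<and>
       (\<forall>k. \<forall>t\<in>circle. circle_dist (\<sigma> (2 ^ n k) t) t < 1 / 2 ^ n k))"

end

theory Submission
  imports Defs
begin

text \<open>
  The run of zeros \<open>r\<^sub>j = 0\<close> for \<open>n < j \<le> 2n\<close> says, for irrational \<open>r\<close>, exactly that
  \<open>2\<^sup>n r\<close> exceeds an integer by less than \<open>1/2\<^sup>n\<close>: multiplication by \<open>2\<^sup>n\<close> moves the first \<open>n\<close> digits
  in front of the binary point, and the next \<open>n\<close> digits of the fractional part vanish
  (\<open>zero_digits_iff_frac_less\<close>). Equivalently, \<open>r\<close> lies in the open set \<open>right_of_dyadic n\<close>, the union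
  of the intervals \<open>(p/2\<^sup>n, p/2\<^sup>n + 1/4\<^sup>n)\<close> over the integers \<open>p\<close>. So \<open>R\<close> consists of the irrational
  points of \<open>(0, 1)\<close> that lie in infinitely many of these sets (\<open>dyadically_recurrent_eq\<close>), and
  everything can be read off from this description.

  Rotating \<open>2\<^sup>n\<close> times by \<open>r\<close> moves each point by the distance of \<open>2\<^sup>n r\<close> to the nearest integer, which
  is at most its fractional part; this is (a). For (b), each tail union of the sets
  \<open>right_of_dyadic n\<close> is open, and dense because \<open>right_of_dyadic n\<close> meets every interval
  \<open>[p/2\<^sup>n, (p+1)/2\<^sup>n)\<close>. Together with the complements of the rational points these are countably many
  dense open sets, so Baire's theorem makes their intersection a dense \<open>G\<^sub>\<delta>\<close> set. On the other hand
  \<open>right_of_dyadic n\<close> occupies only \<open>2\<^sup>n \<sqdot> 4\<^sup>-\<^sup>n = 2\<^sup>-\<^sup>n\<close> of the unit interval, and these measures are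
  summable, so by Borel--Cantelli almost no point lies in infinitely many of these sets.
\<close>

section \<open>Blocks of zeros in binary expansions\<close>

definition binary_partial_sum :: "(nat \<Rightarrow> nat) \<Rightarrow> nat \<Rightarrow> real" where
  "binary_partial_sum b n = (\<Sum>j<n. real (b (Suc j)) / 2 ^ Suc j)"

lemma binary_partial_sum_Suc:
  "binary_partial_sum b (Suc n) = binary_partial_sum b n + real (b (Suc n)) / 2 ^ Suc n"
  by (simp add: binary_partial_sum_def)

lemma binary_partial_sum_mono: "m \<le> n \<Longrightarrow> binary_partial_sum b m \<le> binary_partial_sum b n"
  unfolding binary_partial_sum_def by (intro sum_mono2) auto

lemma power_times_binary_partial_sum_in_Ints: "2 ^ n * binary_partial_sum b n \<in> \<int>"
proof -
  have "2 ^ n * (real (b (Suc j)) / 2 ^ Suc j) \<in> \<int>" if "j < n" for j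
  proof -
    have "n = Suc j + (n - Suc j)"
      using that by simp
    then have "(2::real) ^ n = 2 ^ Suc j * 2 ^ (n - Suc j)"
      by (metis power_add)
    then have "2 ^ n * (real (b (Suc j)) / 2 ^ Suc j) = real (b (Suc j) * 2 ^ (n - Suc j))"
      by (simp add: field_simps)
    then show ?thesis by (metis Ints_of_nat)
  qed
  then show ?thesis
    unfolding binary_partial_sum_def sum_distrib_left by (intro Ints_sum) auto
qed

lemma binary_expansion_LIMSEQ:
  "binary_expansion b r \<Longrightarrow> binary_partial_sum b \<longlonglongrightarrow> r"
  by (simp add: binary_expansion_def sums_def binary_partial_sum_def[abs_def])

lemma binary_partial_sum_le:
  assumes "binary_expansion b r"
  shows "binary_partial_sum b n \<le> r"
  using binary_expansion_LIMSEQ[OF assms]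
  by (rule LIMSEQ_le_const) (auto intro: binary_partial_sum_mono)

lemma le_binary_partial_sum_add:
  assumes "binary_expansion b r"
  shows "r \<le> binary_partial_sum b n + 1 / 2 ^ n"
proof -
  have b: "b (Suc k) \<le> 1" for k
    using assms[unfolded binary_expansion_def, THEN conjunct1, rule_format, of "Suc k"] by auto
  have "decseq (\<lambda>m. binary_partial_sum b m + 1 / 2 ^ m)"
  proof (rule decseq_SucI)
    show "binary_partial_sum b (Suc m) + 1 / 2 ^ Suc m \<le> binary_partial_sum b m + 1 / 2 ^ m" for m
      using b[of m] by (simp add: binary_partial_sum_Suc field_simps)
  qed
  moreover have "(\<lambda>m. binary_partial_sum b m + 1 / 2 ^ m) \<longlonglongrightarrow> r + 0"
    by (intro tendsto_add binary_expansion_LIMSEQ[OF assms] LIMSEQ_divide_realpow_zero) simp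
  ultimately show ?thesis
    using decseq_ge[of "\<lambda>m. binary_partial_sum b m + 1 / 2 ^ m" r n] by simp
qed

text \<open>For irrational \<open>r\<close> the remainder after \<open>n\<close> digits is strictly below \<open>1/2\<^sup>n\<close>, so truncation after
  \<open>n\<close> digits is the same as rounding \<open>2\<^sup>n r\<close> down.\<close>

lemma irrational_less_binary_partial_sum_add:
  assumes "binary_expansion b r" "r \<notin> \<rat>"
  shows "r < binary_partial_sum b n + 1 / 2 ^ n"
proof -
  have "2 ^ n * binary_partial_sum b n / 2 ^ n \<in> \<rat>"
    using power_times_binary_partial_sum_in_Ints[of n b] by (intro Rats_divide) (auto simp: Ints_subset_Rats[THEN subsetD])
  then have "binary_partial_sum b n + 1 / 2 ^ n \<in> \<rat>"
    by simp
  then show ?thesis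
    using assms le_binary_partial_sum_add[OF assms(1), of n] by (metis order_le_less)
qed

lemma frac_power_times_eq_remainder:
  assumes "binary_expansion b r" "r \<notin> \<rat>"
  shows "frac (2 ^ n * r) = 2 ^ n * (r - binary_partial_sum b n)"
  unfolding frac_unique_iff
proof (intro conjI)
  show "2 ^ n * r - 2 ^ n * (r - binary_partial_sum b n) \<in> \<int>"
    using power_times_binary_partial_sum_in_Ints[of n b] by (simp add: algebra_simps)
  show "0 \<le> 2 ^ n * (r - binary_partial_sum b n)"
    using binary_partial_sum_le[OF assms(1)] by simp
  show "2 ^ n * (r - binary_partial_sum b n) < 1"
    using irrational_less_binary_partial_sum_add[OF assms, of n] by (simp add: field_simps)
qed

text \<open>A block of zeros means that truncation after \<open>n\<close> and after \<open>2n\<close> digits agree, so that the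
  remainder after \<open>n\<close> digits is below \<open>1/4\<^sup>n\<close>. Conversely, a digit 1 in the block contributes at least
  \<open>1/4\<^sup>n\<close> to that remainder.\<close>

lemma zero_digits_iff_frac_less:
  assumes "binary_expansion b r" "r \<notin> \<rat>"
  shows "(\<forall>j. n < j \<and> j \<le> 2 * n \<longrightarrow> b j = 0) \<longleftrightarrow> frac (2 ^ n * r) < 1 / 2 ^ n"
proof
  assume zero: "\<forall>j. n < j \<and> j \<le> 2 * n \<longrightarrow> b j = 0"
  have "binary_partial_sum b (n + k) = binary_partial_sum b n" if "k \<le> n" for k
    using that zero by (induction k) (auto simp: binary_partial_sum_Suc)
  then have "binary_partial_sum b (n + n) = binary_partial_sum b n"
    by simp
  then have "r - binary_partial_sum b n < 1 / 2 ^ (n + n)"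
    using irrational_less_binary_partial_sum_add[OF assms, of "n + n"] by simp
  then show "frac (2 ^ n * r) < 1 / 2 ^ n"
    unfolding frac_power_times_eq_remainder[OF assms] by (simp add: power_add field_simps)
next
  assume "frac (2 ^ n * r) < 1 / 2 ^ n"
  then have less: "r - binary_partial_sum b n < 1 / 2 ^ (n + n)"
    unfolding frac_power_times_eq_remainder[OF assms] by (simp add: power_add field_simps)
  show "\<forall>j. n < j \<and> j \<le> 2 * n \<longrightarrow> b j = 0"
  proof (intro allI impI, rule ccontr)
    fix j assume j: "n < j \<and> j \<le> 2 * n" and nz: "b j \<noteq> 0"
    obtain i where i: "j = Suc i"
      using j by (cases j) auto
    have "(1::real) / 2 ^ (n + n) \<le> 1 / 2 ^ j"
      using j by (intro divide_left_mono power_increasing) auto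
    also have "\<dots> \<le> real (b j) / 2 ^ j"
      using nz by (intro divide_right_mono) auto
    also have "\<dots> = binary_partial_sum b j - binary_partial_sum b i"
      by (simp add: i binary_partial_sum_Suc)
    also have "\<dots> \<le> r - binary_partial_sum b n"
      using binary_partial_sum_le[OF assms(1), of j] binary_partial_sum_mono[of n i b] j i by simp
    finally show False
      using less by simp
  qed
qed

lemma binary_expansion_exists:
  assumes "r \<in> circle"
  shows "\<exists>b. binary_expansion b r"
proof -
  define b where "b j = nat (\<lfloor>2 ^ j * r\<rfloor> - 2 * \<lfloor>2 ^ (j - 1) * r\<rfloor>)" for j :: nat
  have digit: "\<lfloor>2 ^ Suc j * r\<rfloor> - 2 * \<lfloor>2 ^ j * r\<rfloor> \<in> {0, 1}" for j :: nat
  proof -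
    have "2 ^ Suc j * r = 2 * (2 ^ j * r)" by simp
    then show ?thesis
      by (simp only:) (simp, linarith)
  qed
  have b_Suc: "real (b (Suc j)) = of_int \<lfloor>2 ^ Suc j * r\<rfloor> - 2 * of_int \<lfloor>2 ^ j * r\<rfloor>" for j
    using digit[of j] by (auto simp: b_def)
  have b01: "b j \<in> {0, 1}" if "j \<ge> 1" for j
    using digit[of "j - 1"] that by (cases j) (auto simp: b_def)
  have partial: "binary_partial_sum b n = of_int \<lfloor>2 ^ n * r\<rfloor> / 2 ^ n" for n
  proof (induction n)
    case 0
    have "\<lfloor>r\<rfloor> = 0"
      using assms by (auto simp: circle_def floor_eq_iff)
    then show ?case by (simp add: binary_partial_sum_def)
  next
    case (Suc n)
    then show ?case
      unfolding binary_partial_sum_Suc b_Suc by (simp add: field_simps)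
  qed
  have "binary_partial_sum b \<longlonglongrightarrow> r"
  proof (rule tendsto_sandwich)
    show "\<forall>\<^sub>F n in sequentially. r - 1 / 2 ^ n \<le> binary_partial_sum b n"
    proof (intro always_eventually allI)
      fix n
      have "2 ^ n * r \<le> of_int \<lfloor>2 ^ n * r\<rfloor> + 1"
        by linarith
      then have "r \<le> (of_int \<lfloor>2 ^ n * r\<rfloor> + 1) / 2 ^ n"
        by (simp add: pos_le_divide_eq mult.commute)
      then show "r - 1 / 2 ^ n \<le> binary_partial_sum b n"
        by (simp add: partial add_divide_distrib)
    qed
    show "\<forall>\<^sub>F n in sequentially. binary_partial_sum b n \<le> r"
    proof (intro always_eventually allI)
      fix n
      have "of_int \<lfloor>2 ^ n * r\<rfloor> \<le> 2 ^ n * r"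
        by linarith
      then show "binary_partial_sum b n \<le> r"
        by (simp add: partial pos_divide_le_eq mult.commute)
    qed
    have "(\<lambda>n. r - 1 / 2 ^ n) \<longlonglongrightarrow> r - 0"
      by (intro tendsto_diff tendsto_const LIMSEQ_divide_realpow_zero) simp
    then show "(\<lambda>n. r - 1 / 2 ^ n) \<longlonglongrightarrow> r" by simp
  qed simp
  then have "binary_expansion b r"
    using b01 by (simp add: binary_expansion_def sums_def binary_partial_sum_def[abs_def])
  then show ?thesis by blast
qed

section \<open>Recurrence as lying in infinitely many open sets\<close>

definition right_of_dyadic :: "nat \<Rightarrow> real set" where
  "right_of_dyadic n = (\<Union>p::int. {p / 2 ^ n <..< p / 2 ^ n + 1 / 4 ^ n})"

lemma open_right_of_dyadic: "open (right_of_dyadic n)"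
  by (auto simp: right_of_dyadic_def)

lemma irrational_in_right_of_dyadic_iff:
  assumes "x \<notin> \<rat>"
  shows "x \<in> right_of_dyadic n \<longleftrightarrow> frac (2 ^ n * x) < 1 / 2 ^ n"
proof -
  have four: "(4::real) ^ n = 2 ^ n * 2 ^ n"
    by (simp flip: power_mult_distrib)
  have interval: "x \<in> {p / 2 ^ n <..< p / 2 ^ n + 1 / 4 ^ n} \<longleftrightarrow>
      of_int p < 2 ^ n * x \<and> 2 ^ n * x - of_int p < 1 / 2 ^ n" for p :: int
    by (auto simp: four field_simps)
  show ?thesis
  proof
    assume "x \<in> right_of_dyadic n"
    then obtain p :: int where p: "of_int p < 2 ^ n * x" "2 ^ n * x - of_int p < 1 / 2 ^ n"
      unfolding right_of_dyadic_def using interval by blast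
    moreover have "(1::real) / 2 ^ n \<le> 1"
      by simp
    ultimately have "\<lfloor>2 ^ n * x\<rfloor> = p"
      unfolding floor_eq_iff by linarith
    then show "frac (2 ^ n * x) < 1 / 2 ^ n"
      using p by (simp add: frac_def)
  next
    assume less: "frac (2 ^ n * x) < 1 / 2 ^ n"
    have "2 ^ n * x \<notin> \<int>"
    proof
      assume "2 ^ n * x \<in> \<int>"
      then have "2 ^ n * x / 2 ^ n \<in> \<rat>"
        by (intro Rats_divide) (auto simp: Ints_subset_Rats[THEN subsetD])
      then show False using assms by simp
    qed
    then have "0 < frac (2 ^ n * x)"
      by simp
    then have "x \<in> {\<lfloor>2 ^ n * x\<rfloor> / 2 ^ n <..< \<lfloor>2 ^ n * x\<rfloor> / 2 ^ n + 1 / 4 ^ n}"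
      unfolding interval using less by (simp add: frac_def)
    then show "x \<in> right_of_dyadic n"
      unfolding right_of_dyadic_def by blast
  qed
qed

lemma ex_filterlim_at_top_iff:
  "(\<exists>n :: nat \<Rightarrow> nat. filterlim n at_top sequentially \<and> (\<forall>k. P (n k))) \<longleftrightarrow> (\<forall>N. \<exists>n\<ge>N. P n)"
proof
  assume "\<exists>n. filterlim n at_top sequentially \<and> (\<forall>k. P (n k))"
  then obtain n where n: "filterlim n at_top sequentially" "\<And>k. P (n k)"
    by blast
  show "\<forall>N. \<exists>n\<ge>N. P n"
  proof
    fix N
    have "\<forall>\<^sub>F k in sequentially. N \<le> n k"
      using n(1) by (simp add: filterlim_at_top)
    then obtain k where "N \<le> n k"
      by (auto simp: eventually_sequentially)
    then show "\<exists>n\<ge>N. P n" using n(2) by blast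
  qed
next
  assume "\<forall>N. \<exists>n\<ge>N. P n"
  then have "infinite {n. P n}"
    by (simp add: infinite_nat_iff_unbounded_le)
  then obtain n :: "nat \<Rightarrow> nat" where "strict_mono n" "\<And>k. P (n k)"
    using infinite_enumerate by blast
  then show "\<exists>n. filterlim n at_top sequentially \<and> (\<forall>k. P (n k))"
    using filterlim_subseq by blast
qed

lemma dyadically_recurrent_iff_frac:
  "dyadically_recurrent r \<longleftrightarrow> r \<in> circle \<and> r \<notin> \<rat> \<and> (\<forall>N. \<exists>n\<ge>N. frac (2 ^ n * r) < 1 / 2 ^ n)"
proof -
  have "(\<exists>b. binary_expansion b r \<and>
          (\<exists>n :: nat \<Rightarrow> nat. filterlim n at_top sequentially \<and>
            (\<forall>k j. n k < j \<and> j \<le> 2 * n k \<longrightarrow> b j = 0))) \<longleftrightarrow>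
        (\<exists>n :: nat \<Rightarrow> nat. filterlim n at_top sequentially \<and> (\<forall>k. frac (2 ^ n k * r) < 1 / 2 ^ n k))"
    if "r \<in> circle" "r \<notin> \<rat>"
    using zero_digits_iff_frac_less[OF _ that(2)] binary_expansion_exists[OF that(1)] by blast
  then show ?thesis
    unfolding dyadically_recurrent_def ex_filterlim_at_top_iff[symmetric] by blast
qed

text \<open>One countable family of subsets of the real line serves both for the \<open>G\<^sub>\<delta>\<close> property, which needs
  open sets, and for Baire's theorem, which needs dense open sets.\<close>

definition recurrence_opens :: "real set set" where
  "recurrence_opens = (\<lambda>q. - {q}) ` \<rat> \<union> range (\<lambda>N. \<Union>n\<in>{N..}. right_of_dyadic n)"

lemma dyadically_recurrent_eq:
  "{r. dyadically_recurrent r} = {0<..<1} \<inter> \<Inter>recurrence_opens"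
proof -
  \<comment> \<open>The left end point of the circle may be dropped, as it is rational.\<close>
  have "r \<in> circle \<longleftrightarrow> r \<in> {0<..<1}" if "r \<notin> \<rat>" for r
  proof -
    have "r \<noteq> 0" using that by auto
    then show ?thesis by (auto simp: circle_def)
  qed
  moreover have "r \<in> \<Inter>recurrence_opens \<longleftrightarrow> r \<notin> \<rat> \<and> (\<forall>N. \<exists>n\<ge>N. r \<in> right_of_dyadic n)" for r
    unfolding recurrence_opens_def Inter_Un_distrib Int_iff INT_iff by auto
  ultimately have "dyadically_recurrent r \<longleftrightarrow> r \<in> {0<..<1} \<inter> \<Inter>recurrence_opens" for r
    unfolding dyadically_recurrent_iff_frac Int_iff
    using irrational_in_right_of_dyadic_iff by metis
  then show ?thesis by blast
qed

lemma countable_recurrence_opens: "countable recurrence_opens"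
  unfolding recurrence_opens_def by (intro countable_Un countable_image countable_rat) auto

lemma open_recurrence_opens: "V \<in> recurrence_opens \<Longrightarrow> open V"
  by (auto simp: recurrence_opens_def intro: open_right_of_dyadic)

section \<open>Rotations by a recurrent angle\<close>

lemma frac_add_frac_right: "frac (x + frac y) = frac (x + y)" for x y :: real
proof -
  have "x + frac y = x + y + of_int (- \<lfloor>y\<rfloor>)"
    by (simp add: frac_def)
  then show ?thesis
    by (metis frac_add_of_int_right)
qed

lemma frac_in_circle: "frac x \<in> circle"
  by (simp add: circle_def frac_lt_1)

lemma rotation_frac: "rotation (frac a) = (\<lambda>t\<in>circle. frac (t + a))"
  by (simp add: rotation_def frac_add_frac_right)

lemma rotation_compose: "compose circle (rotation a) (rotation b) = rotation (a + b)"
proof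
  show "compose circle (rotation a) (rotation b) x = rotation (a + b) x" for x
    using frac_add_frac_right[of a "x + b"]
    by (auto simp: compose_def rotation_def frac_in_circle algebra_simps)
qed

lemma rotation_0: "rotation 0 = (\<lambda>t\<in>circle. t)"
  by (auto simp: rotation_def circle_def fun_eq_iff)

lemma rotation_in_Bij: "rotation a \<in> Bij circle"
proof -
  have inverse: "rotation (- c) (rotation c t) = t" if "t \<in> circle" for c t
    using that fun_cong[OF rotation_compose[of "- c" c], of t]
    by (simp add: compose_def rotation_0)
  have maps: "rotation c t \<in> circle" if "t \<in> circle" for c t
    using that by (simp add: rotation_def frac_in_circle)
  have "bij_betw (rotation a) circle circle"
    using inverse[of _ a] inverse[of _ "- a"] maps
    by (intro bij_betw_byWitness[where f' = "rotation (- a)"]) auto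
  then show ?thesis
    by (simp add: Bij_def rotation_def)
qed

lemma rotation_action_multiples: "rotation_action (\<lambda>z. rotation (of_int z * r))"
proof -
  have "(\<lambda>z. rotation (of_int z * r)) \<in> hom integer_group (BijGroup circle)"
    by (auto simp: hom_def BijGroup_def rotation_in_Bij rotation_compose algebra_simps)
  then have "group_action integer_group circle (\<lambda>z. rotation (of_int z * r))"
    by (intro group_action.intro group_hom.intro group_hom_axioms.intro group_BijGroup) auto
  moreover have "rotation (of_int z * r) = rotation (frac (of_int z * r))" for z
    unfolding rotation_frac by (simp add: rotation_def)
  ultimately show ?thesis
    unfolding rotation_action_def using frac_in_circle by blast
qed

lemma circle_dist_frac_add_le: "circle_dist (frac (t + a)) t \<le> frac a"
proof -
  have "circle_dist (frac (t + a)) t \<le> dist (frac (t + a) - t) (of_int (\<lfloor>a\<rfloor> - \<lfloor>t + a\<rfloor>))"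
    unfolding circle_dist_def by (rule infdist_le) (rule Ints_of_int)
  also have "\<dots> = frac a"
    using frac_ge_0[of a] by (simp add: dist_real_def frac_def)
  finally show ?thesis .
qed

lemma dyadically_recurrent_rotation_action:
  assumes "dyadically_recurrent r"
  shows "dyadically_recurrent_action (\<lambda>z. rotation (of_int z * r))"
proof -
  obtain n :: "nat \<Rightarrow> nat"
    where n: "filterlim n at_top sequentially" "\<And>k. frac (2 ^ n k * r) < 1 / 2 ^ n k"
    using assms unfolding dyadically_recurrent_iff_frac ex_filterlim_at_top_iff[symmetric] by blast
  have "circle_dist (rotation (of_int (2 ^ n k) * r) t) t < 1 / 2 ^ n k" if "t \<in> circle" for k t
    using circle_dist_frac_add_le[of t "2 ^ n k * r"] n(2)[of k] that by (simp add: rotation_def)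
  then show ?thesis
    unfolding dyadically_recurrent_action_def using n(1) rotation_action_multiples by blast
qed

section \<open>Density and the \<open>G\<^sub>\<delta>\<close> property\<close>

lemma topspace_circle_topology: "topspace circle_topology = circle"
  by (simp add: circle_topology_def Metric_space.topspace_mtopology[OF Metric_space_circle])

lemma circle_dist_le: "circle_dist x y \<le> \<bar>x - y\<bar>"
  using infdist_le[of 0 \<int> "x - y"] by (simp add: circle_dist_def)

text \<open>Within the distance of \<open>x\<close> to the cut point \<open>0 = 1\<close> of the circle, no shorter way leads around
  that point, and the quotient metric controls the usual one.\<close>

lemma abs_diff_less_if_circle_dist_less:
  assumes "circle_dist x y < e" "y \<in> circle" "e \<le> x" "e \<le> 1 - x"
  shows "\<bar>x - y\<bar> < e"
proof -
  obtain a where "a \<in> \<int>" "infdist (x - y) \<int> = dist (x - y) a"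
    using infdist_attains_inf[OF closed_Ints, of "x - y"] Ints_0 by (metis empty_iff)
  then obtain m :: int where m: "\<bar>x - y - of_int m\<bar> < e"
    using assms(1) by (auto simp: circle_dist_def dist_real_def elim!: Ints_cases)
  have "\<not> m \<ge> 1"
  proof
    assume "m \<ge> 1"
    then have "real_of_int m \<ge> 1" by simp
    then show False using m assms by (auto simp: circle_def)
  qed
  moreover have "\<not> m \<le> - 1"
  proof
    assume "m \<le> - 1"
    then have "real_of_int m \<le> - 1" by linarith
    then show False using m assms by (auto simp: circle_def)
  qed
  ultimately have "m = 0" by linarith
  then show ?thesis using m by simp
qed

lemma openin_circle_topology:
  assumes "open V" "V \<subseteq> {0<..<1}"
  shows "openin circle_topology V"
  unfolding circle_topology_def Metric_space.openin_mtopology[OF Metric_space_circle]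
proof (intro conjI allI impI)
  show "V \<subseteq> circle"
    using assms(2) by (auto simp: circle_def)
  fix x assume x: "x \<in> V"
  then obtain e where e: "e > 0" "\<And>y. \<bar>x - y\<bar> < e \<Longrightarrow> y \<in> V"
    using assms(1) unfolding open_dist dist_real_def by (metis abs_minus_commute)
  define \<delta> where "\<delta> = min e (min x (1 - x))"
  have "\<delta> > 0"
    using subsetD[OF assms(2) x] e(1) by (auto simp: \<delta>_def)
  moreover have "y \<in> V" if "y \<in> circle" "circle_dist x y < \<delta>" for y
    using abs_diff_less_if_circle_dist_less[OF that(2,1)] e(2)[of y] by (simp add: \<delta>_def)
  ultimately show "\<exists>r>0. Metric_space.mball circle circle_dist x r \<subseteq> V"
    by (auto simp: Metric_space.in_mball[OF Metric_space_circle] intro!: exI[of _ \<delta>])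
qed

lemma gdelta_in_dyadically_recurrent: "gdelta_in circle_topology {r. dyadically_recurrent r}"
proof -
  have "{r. dyadically_recurrent r} = \<Inter>((\<inter>) {0<..<1} ` recurrence_opens)"
    unfolding dyadically_recurrent_eq by (auto simp: recurrence_opens_def)
  moreover have "gdelta_in circle_topology (\<Inter>((\<inter>) {0<..<1} ` recurrence_opens))"
  proof (rule gdelta_in_Inter)
    show "countable ((\<inter>) {0<..<1} ` recurrence_opens)"
      by (intro countable_image countable_recurrence_opens)
    show "(\<inter>) {0<..<1} ` recurrence_opens \<noteq> {}"
      by (auto simp: recurrence_opens_def)
    show "gdelta_in circle_topology S" if "S \<in> (\<inter>) {0<..<1} ` recurrence_opens" for S
      using that
      by (auto intro!: open_imp_gdelta_in openin_circle_topology dest: open_recurrence_opens)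
  qed
  ultimately show ?thesis by simp
qed

lemma right_of_dyadic_meets:
  "\<exists>y\<in>right_of_dyadic n. \<bar>y - x\<bar> < 1 / 2 ^ n"
proof -
  define p where "p = \<lfloor>2 ^ n * x\<rfloor>"
  define y :: real where "y = p / 2 ^ n + 1 / (2 * 4 ^ n)"
  have "y \<in> right_of_dyadic n"
    unfolding right_of_dyadic_def y_def by (auto intro!: exI[of _ p] simp: field_simps)
  moreover have "p / 2 ^ n \<le> x" "x < p / 2 ^ n + 1 / 2 ^ n"
  proof -
    have "of_int p \<le> 2 ^ n * x" "2 ^ n * x < of_int p + 1"
      unfolding p_def by linarith+
    then show "p / 2 ^ n \<le> x" "x < p / 2 ^ n + 1 / 2 ^ n"
      by (auto simp: field_simps)
  qed
  moreover have "0 < 1 / (2 * (4::real) ^ n)" "1 / (2 * 4 ^ n) < 1 / (2::real) ^ n"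
  proof -
    have "(2::real) ^ n < 2 * 4 ^ n"
      using power_mono[of "2::real" 4 n] zero_less_power[of "4::real" n] by linarith
    then show "1 / (2 * 4 ^ n) < 1 / (2::real) ^ n"
      by (intro divide_strict_left_mono) auto
  qed simp
  ultimately show ?thesis
    by (intro bexI[of _ y]) (unfold y_def, linarith)
qed

lemma dense_recurrence_opens:
  assumes "V \<in> recurrence_opens"
  shows "closure V = UNIV"
proof -
  have "x \<in> closure (\<Union>n\<in>{N..}. right_of_dyadic n)" for x N
    unfolding closure_approachable
  proof (intro allI impI)
    fix e :: real assume "e > 0"
    then obtain k where k: "(1/2) ^ k < e"
      using real_arch_pow_inv[of e "1/2"] by auto
    define n where "n = max N k"
    have "(1/2::real) ^ n \<le> (1/2) ^ k"
      by (intro power_decreasing) (auto simp: n_def)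
    then have "1 / 2 ^ n < e"
      using k by (simp add: power_one_over)
    then obtain y where "y \<in> right_of_dyadic n" "\<bar>y - x\<bar> < e"
      using right_of_dyadic_meets[of n x] by force
    moreover have "n \<in> {N..}"
      by (simp add: n_def)
    ultimately show "\<exists>y\<in>\<Union>n\<in>{N..}. right_of_dyadic n. dist y x < e"
      unfolding dist_real_def by blast
  qed
  moreover have "closure (- {q}) = UNIV" for q :: real
    by (simp add: closure_complement)
  ultimately show ?thesis
    using assms by (auto simp: recurrence_opens_def)
qed

lemma closure_of_dyadically_recurrent:
  "circle_topology closure_of {r. dyadically_recurrent r} = circle"
proof -
  have "UNIV \<subseteq> closure (\<Inter>recurrence_opens)"
    by (rule Baire) (auto simp: countable_recurrence_opens open_recurrence_opens dense_recurrence_opens)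
  then have dense: "closure (\<Inter>recurrence_opens) = UNIV"
    by auto
  have "\<exists>y. dyadically_recurrent y \<and> y \<in> circle \<and> circle_dist x y < e"
    if x: "x \<in> circle" and "e > 0" for x e
  proof -
    \<comment> \<open>Recurrent points are sought to the right of \<open>x\<close>, where there is room even if \<open>x = 0\<close>.\<close>
    define I where "I = {x <..< min 1 (x + e)}"
    have "I \<noteq> {}" "open I"
      using that by (auto simp: I_def circle_def)
    then have "I \<inter> \<Inter>recurrence_opens \<noteq> {}"
      using open_Int_closure_eq_empty[of I "\<Inter>recurrence_opens"] dense by auto
    then obtain y where y: "y \<in> I" "y \<in> \<Inter>recurrence_opens"
      by blast
    then have "y \<in> {0<..<1} \<inter> \<Inter>recurrence_opens"
      using x by (auto simp: I_def circle_def)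
    then have "dyadically_recurrent y"
      unfolding dyadically_recurrent_eq[symmetric] by simp
    moreover have "\<bar>x - y\<bar> < e" "y \<in> circle"
      using x y(1) by (auto simp: I_def circle_def)
    ultimately show ?thesis
      using circle_dist_le[of x y] by (intro exI[of _ y]) auto
  qed
  then show ?thesis
    unfolding circle_topology_def Metric_space.metric_closure_of[OF Metric_space_circle]
    by (auto simp: Metric_space.in_mball[OF Metric_space_circle])
qed

section \<open>Measure zero\<close>

text \<open>Of the intervals that make up \<open>right_of_dyadic n\<close>, only the \<open>2\<^sup>n\<close> ones with \<open>0 \<le> p < 2\<^sup>n\<close> meet the
  unit interval.\<close>

lemma emeasure_right_of_dyadic_le:
  "emeasure lebesgue ({0<..<1} \<inter> right_of_dyadic n) \<le> ennreal ((1/2) ^ n)"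
proof -
  define J where "J p = {real_of_int p / 2 ^ n <..< p / 2 ^ n + 1 / 4 ^ n}" for p
  have "{0<..<1} \<inter> right_of_dyadic n \<subseteq> (\<Union>p\<in>{0..<2 ^ n}. J p)"
  proof
    fix x assume x: "x \<in> {0<..<1} \<inter> right_of_dyadic n"
    then obtain p where p: "x \<in> J p"
      by (auto simp: right_of_dyadic_def J_def)
    have "(1::real) / 4 ^ n \<le> 1 / 2 ^ n"
      by (intro divide_left_mono power_mono) auto
    then have "0 < real_of_int p / 2 ^ n + 1 / 2 ^ n" "real_of_int p / 2 ^ n < 1"
      using p x unfolding J_def Int_iff greaterThanLessThan_iff by linarith+
    then have "- 1 < real_of_int p" "real_of_int p < 2 ^ n"
      by (auto simp: field_simps)
    then have "p \<in> {0..<2 ^ n}"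
      using of_int_less_iff[of p "2 ^ n", where 'a = real] by auto
    then show "x \<in> (\<Union>p\<in>{0..<2 ^ n}. J p)"
      using p by blast
  qed
  then have "emeasure lebesgue ({0<..<1} \<inter> right_of_dyadic n) \<le> emeasure lebesgue (\<Union>p\<in>{0..<2 ^ n}. J p)"
    by (intro emeasure_mono) (auto simp: J_def)
  also have "\<dots> \<le> (\<Sum>p\<in>{0..<2 ^ n}. emeasure lebesgue (J p))"
    by (intro emeasure_subadditive_finite) (auto simp: J_def)
  also have "\<dots> = (\<Sum>p\<in>{0..<2 ^ n :: int}. ennreal (1 / 4 ^ n))"
    by (simp add: J_def)
  also have "\<dots> = ennreal (2 ^ n * (1 / 4 ^ n))"
    by (simp add: ennreal_of_nat_eq_real_of_nat nat_power_eq flip: ennreal_mult')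
  also have "2 ^ n * (1 / 4 ^ n) = (1/2::real) ^ n"
    by (simp add: power_divide[symmetric])
  finally show ?thesis .
qed

lemma null_sets_dyadically_recurrent: "{r. dyadically_recurrent r} \<in> null_sets lebesgue"
proof -
  let ?A = "\<lambda>n. {0<..<1} \<inter> right_of_dyadic n"
  have finite: "emeasure lebesgue (?A n) < \<infinity>" for n
    using emeasure_right_of_dyadic_le[of n] by (auto intro: le_less_trans)
  have "limsup ?A \<in> null_sets lebesgue"
  proof (rule borel_cantelli_limsup1)
    show "?A n \<in> sets lebesgue" for n
      using open_right_of_dyadic[of n] by (auto intro!: borel_open)
    show "summable (\<lambda>n. measure lebesgue (?A n))"
    proof (rule summable_comparison_test'[OF summable_geometric, of "1/2" 0])
      show "norm (measure lebesgue (?A n)) \<le> (1/2) ^ n" for n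
        using emeasure_right_of_dyadic_le[of n] by (simp add: measure_def enn2real_leI)
    qed simp
  qed (rule finite)
  moreover have "{r. dyadically_recurrent r} \<subseteq> limsup ?A"
    unfolding dyadically_recurrent_eq by (auto simp: limsup_INF_SUP recurrence_opens_def)
  ultimately show ?thesis
    by (rule null_sets_completion_subset[rotated])
qed

theorem proposition15p3:
  fixes R :: "real set"
  assumes "R = {r. dyadically_recurrent r}"
  shows "(\<forall>r\<in>R. dyadically_recurrent_action (\<lambda>z. \<lambda>t\<in>circle. frac (t + of_int z * r))) \<and>
    circle_topology closure_of R = topspace circle_topology \<and>
    gdelta_in circle_topology R \<and>
    R \<in> null_sets (lebesgue_on circle)"
proof (intro conjI ballI)
  show "dyadically_recurrent_action (\<lambda>z. \<lambda>t\<in>circle. frac (t + of_int z * r))" if "r \<in> R" for r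
    using dyadically_recurrent_rotation_action[of r] that assms by (simp add: rotation_def)
  show "circle_topology closure_of R = topspace circle_topology"
    by (simp add: assms closure_of_dyadically_recurrent topspace_circle_topology)
  show "gdelta_in circle_topology R"
    by (simp add: assms gdelta_in_dyadically_recurrent)
  have "R \<subseteq> circle"
    by (auto simp: assms dyadically_recurrent_def)
  then show "R \<in> null_sets (lebesgue_on circle)"
    using null_sets_dyadically_recurrent assms
    by (simp add: null_sets_restrict_space circle_def)
qed

end
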